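(* The Vámos matroid $V_8$ is not representable over any skew partial field.
   Context: A skew partial field is a pair $\mathbb{P}=(R,G)$ with $R$ a (not necessarily commutative) ring with identity and $G$ a subgroup of the units $R^*$ with $-1\in G$. An $R$-chain group on a finite set $E$ is a subset of $R^E$ containing $0$ and closed under componentwise addition and left scalar multiplication. A chain $c$ is elementary in $C$ if $c\ne0$ and no nonzero chain of $C$ has support strictly contained in $\|c\|=\{e:c_e\ne0\}$; $c$ is $G$-primitive if its entries lie in $G\cup\{0\}$. A $\mathbb{P}$-chain group is an $R$-chain group in which every elementary chain equals $rc'$ with $r\in R$, $c'$ a $G$-primitive chain of the group; $M(C)$ is the matroid on $E$ whose cocircuits are the supports of the elementary chains of $C$. A matroid $M$ is representable over $\mathbb{P}$ if $M=M(C)$ for some $\mathbb{P}$-chain group $C$. The Vámos matroid $V_8$ is the rank-4 matroid on $\{1,\dots,8\}$ in which every set of at most 3 elements is independent and the 4-element dependent sets (circuits) are exactly $\{1,2,5,6\},\{1,2,7,8\},\{3,4,5,6\},\{3,4,7,8\},\{5,6,7,8\}$; all other 4-element sets (in particular $\{1,2,3,4\}$) are bases. *)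

theory Defs
  imports "HOL-Algebra.Ring"
begin

section \<open>Matroids\<close>

locale matroid =
  fixes E :: "'e set" and I :: "'e set set"
  assumes finite_ground: "finite E"
    and indep_ground: "X \<in> I \<Longrightarrow> X \<subseteq> E"
    and indep_empty: "{} \<in> I"
    and indep_subset: "X \<in> I \<Longrightarrow> Y \<subseteq> X \<Longrightarrow> Y \<in> I"
    and indep_augment: "X \<in> I \<Longrightarrow> Y \<in> I \<Longrightarrow> card X < card Y \<Longrightarrow> \<exists>y\<in>Y - X. insert y X \<in> I"

definition bases :: "'e set set \<Rightarrow> 'e set set" where
  "bases I = {B \<in> I. \<forall>X\<in>I. B \<subseteq> X \<longrightarrow> X = B}"

definition circuits :: "'e set \<Rightarrow> 'e set set \<Rightarrow> 'e set set" where
  "circuits E I = {X. X \<subseteq> E \<and> X \<notin> I \<and> (\<forall>Y. Y \<subset> X \<longrightarrow> Y \<in> I)}"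

definition dual_indep :: "'e set \<Rightarrow> 'e set set \<Rightarrow> 'e set set" where
  "dual_indep E I = {X. X \<subseteq> E \<and> (\<exists>B\<in>bases I. X \<inter> B = {})}"

definition cocircuits :: "'e set \<Rightarrow> 'e set set \<Rightarrow> 'e set set" where
  "cocircuits E I = circuits E (dual_indep E I)"

lemma contains_circuit:
  assumes "finite X" "X \<subseteq> E" "X \<notin> I"
  shows "\<exists>D\<in>circuits E I. D \<subseteq> X"
  using assms
proof (induction X rule: finite_psubset_induct)
  case (psubset X)
  show ?case
  proof (cases "\<forall>Y. Y \<subset> X \<longrightarrow> Y \<in> I")
    case True
    then show ?thesis using psubset.prems by (auto simp: circuits_def)
  next
    case False
    then obtain Y where "Y \<subset> X" "Y \<notin> I" by blast
    with psubset.IH[of Y] psubset.prems show ?thesis by blast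
  qed
qed

context matroid
begin

lemma indep_in_basis:
  assumes "X \<in> I"
  shows "\<exists>B\<in>bases I. X \<subseteq> B"
proof -
  have "finite {Y \<in> I. X \<subseteq> Y}"
    using finite_ground indep_ground by (auto intro: finite_subset[of _ "Pow E"])
  moreover have "X \<in> {Y \<in> I. X \<subseteq> Y}" using assms by simp
  ultimately obtain B where "B \<in> {Y \<in> I. X \<subseteq> Y}"
      "\<forall>Y\<in>{Y \<in> I. X \<subseteq> Y}. B \<le> Y \<longrightarrow> B = Y"
    by (meson finite_has_maximal2)
  then have "B \<in> bases I" "X \<subseteq> B"
    unfolding bases_def by blast+
  then show ?thesis by blast
qed

lemma indep_iff_basis: "X \<in> I \<longleftrightarrow> (\<exists>B\<in>bases I. X \<subseteq> B)"
  using indep_in_basis indep_subset by (auto simp: bases_def)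

lemma dual_indep_iff:
  "X \<in> dual_indep E I \<longleftrightarrow> X \<subseteq> E \<and> \<not> (\<exists>D\<in>cocircuits E I. D \<subseteq> X)"
proof
  assume X: "X \<in> dual_indep E I"
  have "\<not> D \<subseteq> X" if "D \<in> cocircuits E I" for D
  proof
    assume "D \<subseteq> X"
    with X have "D \<in> dual_indep E I" unfolding dual_indep_def by blast
    with that show False by (simp add: cocircuits_def circuits_def)
  qed
  with X show "X \<subseteq> E \<and> \<not> (\<exists>D\<in>cocircuits E I. D \<subseteq> X)"
    unfolding dual_indep_def by blast
next
  assume "X \<subseteq> E \<and> \<not> (\<exists>D\<in>cocircuits E I. D \<subseteq> X)"
  then show "X \<in> dual_indep E I"
    using contains_circuit[of X E "dual_indep E I"] finite_ground finite_subset
    unfolding cocircuits_def by blast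
qed

lemma bases_ground: "B \<in> bases I \<Longrightarrow> B \<subseteq> E"
  using indep_ground by (simp add: bases_def)

lemma bases_antichain: "B \<in> bases I \<Longrightarrow> B' \<in> bases I \<Longrightarrow> B' \<subseteq> B \<Longrightarrow> B' = B"
  by (simp add: bases_def)

lemma bases_iff_dual: "B \<in> bases I \<longleftrightarrow> B \<subseteq> E \<and> E - B \<in> bases (dual_indep E I)"
proof
  assume B: "B \<in> bases I"
  note BE = bases_ground[OF B]
  have "Y = E - B" if Y: "Y \<in> dual_indep E I" "E - B \<subseteq> Y" for Y
  proof -
    obtain B' where B': "B' \<in> bases I" "Y \<inter> B' = {}" "Y \<subseteq> E"
      using Y by (auto simp: dual_indep_def)
    have "B' \<subseteq> B" using Y(2) B'(2) bases_ground[OF B'(1)] by blast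
    then have "B' = B" using bases_antichain B B'(1) by blast
    then show ?thesis using B'(2,3) Y(2) by blast
  qed
  moreover have "E - B \<in> dual_indep E I"
    unfolding dual_indep_def using B by blast
  ultimately show "B \<subseteq> E \<and> E - B \<in> bases (dual_indep E I)"
    using BE by (simp add: bases_def[of "dual_indep E I"])
next
  assume B: "B \<subseteq> E \<and> E - B \<in> bases (dual_indep E I)"
  then have "E - B \<in> dual_indep E I"
    by (simp add: bases_def[of "dual_indep E I"])
  then obtain B' where B': "B' \<in> bases I" "(E - B) \<inter> B' = {}"
    unfolding dual_indep_def by blast
  have sub: "B' \<subseteq> B" using B'(2) bases_ground[OF B'(1)] by blast
  have "E - B' \<in> dual_indep E I"
    unfolding dual_indep_def using B'(1) by blast
  moreover have "E - B \<subseteq> E - B'" using sub by blast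
  ultimately have "E - B' = E - B"
    using B by (simp add: bases_def[of "dual_indep E I"])
  then have "B' = B" using B sub by blast
  then show "B \<in> bases I" using B'(1) by simp
qed

end

lemma matroid_determined_by_cocircuits:
  assumes "matroid E I" "matroid E J" "cocircuits E I = cocircuits E J"
  shows "I = J"
proof -
  interpret I: matroid E I by fact
  interpret J: matroid E J by fact
  have "dual_indep E I = dual_indep E J"
    using I.dual_indep_iff J.dual_indep_iff assms(3) by auto
  then have "bases I = bases J"
    using I.bases_iff_dual J.bases_iff_dual by auto
  then show ?thesis
    using I.indep_iff_basis J.indep_iff_basis by auto
qed

section \<open>Skew partial fields and chain groups\<close>

locale skew_partial_field = ring R for R (structure) +
  fixes G
  assumes subgroup_units: "subgroup G (units_of R)"
    and minus_one: "\<ominus> \<one> \<in> G"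

text \<open>The elements of \<open>R\<^sup>E\<close> are rendered as extensional functions on \<open>E\<close>.\<close>

locale chain_group = ring R for R (structure) +
  fixes E :: "'e set" and C :: "('e \<Rightarrow> 'a) set"
  assumes finite_set: "finite E"
    and chains: "C \<subseteq> E \<rightarrow>\<^sub>E carrier R"
    and zero_chain: "(\<lambda>e\<in>E. \<zero>) \<in> C"
    and add_chain: "f \<in> C \<Longrightarrow> g \<in> C \<Longrightarrow> (\<lambda>e\<in>E. f e \<oplus> g e) \<in> C"
    and smult_chain: "r \<in> carrier R \<Longrightarrow> f \<in> C \<Longrightarrow> (\<lambda>e\<in>E. r \<otimes> f e) \<in> C"

definition chain_support :: "('a, 'b) ring_scheme \<Rightarrow> 'e set \<Rightarrow> ('e \<Rightarrow> 'a) \<Rightarrow> 'e set" where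
  "chain_support R E c = {e \<in> E. c e \<noteq> \<zero>\<^bsub>R\<^esub>}"

definition elementary_chains ::
  "('a, 'b) ring_scheme \<Rightarrow> 'e set \<Rightarrow> ('e \<Rightarrow> 'a) set \<Rightarrow> ('e \<Rightarrow> 'a) set" where
  "elementary_chains R E C = {c \<in> C. c \<noteq> (\<lambda>e\<in>E. \<zero>\<^bsub>R\<^esub>) \<and>
     \<not> (\<exists>d\<in>C. d \<noteq> (\<lambda>e\<in>E. \<zero>\<^bsub>R\<^esub>) \<and> chain_support R E d \<subset> chain_support R E c)}"

definition primitive_chain ::
  "('a, 'b) ring_scheme \<Rightarrow> 'a set \<Rightarrow> 'e set \<Rightarrow> ('e \<Rightarrow> 'a) \<Rightarrow> bool" where
  "primitive_chain R G E c \<longleftrightarrow> (\<forall>e\<in>E. c e \<in> G \<union> {\<zero>\<^bsub>R\<^esub>})"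

locale partial_field_chain_group = skew_partial_field R G + chain_group R E C
  for R (structure) and G and E :: "'e set" and C +
  assumes elementary_multiple: "c \<in> elementary_chains R E C \<Longrightarrow>
    \<exists>r\<in>carrier R. \<exists>c'\<in>C. primitive_chain R G E c' \<and> c = (\<lambda>e\<in>E. r \<otimes> c' e)"

text \<open>The predicate below says that \<open>(E, I)\<close> is \<open>M(C)\<close>; such an \<open>I\<close> is unique
  by \<open>matroid_determined_by_cocircuits\<close>.\<close>

definition is_chain_group_matroid ::
  "('a, 'b) ring_scheme \<Rightarrow> 'e set \<Rightarrow> ('e \<Rightarrow> 'a) set \<Rightarrow> 'e set set \<Rightarrow> bool" where
  "is_chain_group_matroid R E C I \<longleftrightarrow>
     matroid E I \<and> cocircuits E I = chain_support R E ` elementary_chains R E C"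

definition representable ::
  "('a, 'b) ring_scheme \<Rightarrow> 'a set \<Rightarrow> 'e set \<Rightarrow> 'e set set \<Rightarrow> bool" where
  "representable R G E I \<longleftrightarrow>
     (\<exists>C. partial_field_chain_group R G E C \<and> is_chain_group_matroid R E C I)"

section \<open>The Vamos matroid\<close>

definition vamos_ground :: "nat set" where
  "vamos_ground = {1..8}"

definition vamos_planes :: "nat set set" where
  "vamos_planes = {{1,2,5,6}, {1,2,7,8}, {3,4,5,6}, {3,4,7,8}, {5,6,7,8}}"

definition vamos_indep :: "nat set set" where
  "vamos_indep = {X. X \<subseteq> vamos_ground \<and> card X \<le> 4 \<and> X \<notin> vamos_planes}"

lemma vamos_planes_card: "P \<in> vamos_planes \<Longrightarrow> card P = 4"
  unfolding vamos_planes_def by (elim insertE emptyE) simp_all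

lemma vamos_planes_inter:
  "P \<in> vamos_planes \<Longrightarrow> Q \<in> vamos_planes \<Longrightarrow> P \<noteq> Q \<Longrightarrow> card (P \<inter> Q) \<le> 2"
  unfolding vamos_planes_def by (elim insertE emptyE) simp_all

lemma vamos_matroid: "matroid vamos_ground vamos_indep"
proof
  show fin: "finite vamos_ground" by (simp add: vamos_ground_def)
  show "X \<subseteq> vamos_ground" if "X \<in> vamos_indep" for X
    using that by (simp add: vamos_indep_def)
  show "{} \<in> vamos_indep"
    using vamos_planes_card[of "{}"] by (auto simp: vamos_indep_def)
  show "Y \<in> vamos_indep" if X: "X \<in> vamos_indep" and Y: "Y \<subseteq> X" for X Y
  proof (cases "Y = X")
    case False
    have finX: "finite X" using X fin finite_subset by (auto simp: vamos_indep_def)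
    then have "card Y < card X" using False Y by (meson psubsetI psubset_card_mono)
    then have "card Y < 4" using X by (simp add: vamos_indep_def)
    then show ?thesis
      using X Y vamos_planes_card[of Y] by (auto simp: vamos_indep_def)
  qed (use X in simp)
  show "\<exists>y\<in>Y - X. insert y X \<in> vamos_indep"
    if X: "X \<in> vamos_indep" and Y: "Y \<in> vamos_indep" and lt: "card X < card Y" for X Y
  proof (rule ccontr)
    assume neg: "\<not> ?thesis"
    have finX: "finite X" and finY: "finite Y"
      using X Y fin finite_subset by (auto simp: vamos_indep_def)
    have plane: "insert y X \<in> vamos_planes" if "y \<in> Y - X" for y
      using neg that X Y lt finX by (auto simp: vamos_indep_def)
    have "\<not> Y \<subseteq> X" using lt card_mono[OF finX, of Y] by linarith
    then obtain y where y: "y \<in> Y - X" by blast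
    have cX: "card X = 3" using vamos_planes_card[OF plane[OF y]] y finX by simp
    show False
    proof (cases "Y - X = {y}")
      case True
      then have "Y \<subseteq> insert y X" by blast
      moreover have "card (insert y X) \<le> card Y" using lt y finX by simp
      ultimately have "Y = insert y X" using finX by (meson card_seteq finite_insert)
      then show False using plane[OF y] Y by (simp add: vamos_indep_def)
    next
      case False
      then obtain z where z: "z \<in> Y - X" "z \<noteq> y" using y by blast
      have "insert y X \<noteq> insert z X" using y z by blast
      from vamos_planes_inter[OF plane[OF y] plane[OF z(1)] this]
      have "card (insert y X \<inter> insert z X) \<le> 2" .
      moreover have "insert y X \<inter> insert z X = X" using y z by blast
      ultimately show False using cX by simp
    qed
  qed
qed

end

theory Submission
  imports Defs "HOL-Algebra.Multiplicative_Group"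
begin

text \<open>Work with the relations \<open>x\<close> satisfied by a chain group, that is, the columns orthogonal to all
  its chains; they form a right module. Every circuit supports a relation whose entries on the
  circuit are units, and a relation supported on a basis vanishes. Geometrically, the lines 56 and
  78 of the Vamos matroid meet in a point, and both 12 and 34 must pass through it, which makes
  1234 coplanar. Algebraically, scale the relations of 1256 and 1278 so that they agree with the
  relation \<open>p\<close> of 5678 at 5 and 7; subtracting both from \<open>p\<close> leaves a relation on the basis 1268,
  so the relation of 1256 agrees with \<open>p\<close> at 6 too. The same holds for 3456, and the
  difference of the relations of 1256 and 3456 lives on the basis 1234.\<close>

section \<open>Bases, circuits and cocircuits of a matroid\<close>

context matroid
begin

lemma cocircuit_subset: "D \<in> cocircuits E I \<Longrightarrow> D \<subseteq> E"
  by (simp add: cocircuits_def circuits_def)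

lemma basis_meets_cocircuit:
  assumes "B \<in> bases I" "D \<in> cocircuits E I"
  shows "B \<inter> D \<noteq> {}"
proof
  assume "B \<inter> D = {}"
  then have "D \<in> dual_indep E I"
    using assms cocircuit_subset by (auto simp: dual_indep_def)
  then show False using assms(2) by (simp add: cocircuits_def circuits_def)
qed

text \<open>A basis avoiding \<open>insert b (E - B)\<close> would lie properly inside
  \<open>B\<close>, so this set contains a cocircuit. The cocircuit has to meet \<open>B\<close>,
  and \<open>b\<close> is the only place where it can.\<close>

lemma fundamental_cocircuit:
  assumes B: "B \<in> bases I" and b: "b \<in> B"
  obtains D where "D \<in> cocircuits E I" "D \<inter> B = {b}"
proof -
  let ?X = "insert b (E - B)"
  have BE: "B \<subseteq> E" using bases_ground[OF B] .
  have "?X \<notin> dual_indep E I"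
  proof
    assume "?X \<in> dual_indep E I"
    then obtain B' where B': "B' \<in> bases I" "?X \<inter> B' = {}" by (auto simp: dual_indep_def)
    then have "B' \<subseteq> B" "b \<notin> B'" using bases_ground[OF B'(1)] by blast+
    then show False using bases_antichain[OF B B'(1)] b by blast
  qed
  then obtain D where D: "D \<in> cocircuits E I" "D \<subseteq> ?X"
    using dual_indep_iff BE b by auto
  moreover have "D \<inter> B = {b}"
    using D(2) basis_meets_cocircuit[OF B D(1)] by blast
  ultimately show ?thesis using that by blast
qed

text \<open>A strictly larger independent set \<open>Y\<close> would have more elements than
  \<open>B\<close> and so would augment \<open>B\<close>, contradicting its maximality.\<close>

lemma indep_card_basis:
  assumes X: "X \<in> I" and B: "B \<in> bases I" and le: "card B \<le> card X"
  shows "X \<in> bases I"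
proof -
  have "Y = X" if Y: "Y \<in> I" "X \<subseteq> Y" for Y
  proof (rule ccontr)
    assume "Y \<noteq> X"
    have "finite Y" using Y indep_ground finite_ground finite_subset by blast
    then have "card X < card Y" using Y \<open>Y \<noteq> X\<close> by (metis psubsetI psubset_card_mono)
    then obtain y where "y \<in> Y - B" "insert y B \<in> I"
      using indep_augment[of B Y] B Y le by (auto simp: bases_def)
    then show False using B by (auto simp: bases_def)
  qed
  then show ?thesis using X by (simp add: bases_def)
qed

text \<open>A maximal independent set between \<open>X\<close> and \<open>X \<union> B\<close> is at
  least as large as \<open>B\<close>, since otherwise augmentation would supply one more element of
  \<open>B\<close>.\<close>

lemma indep_extend_from_basis:
  assumes X: "X \<in> I" and B: "B \<in> bases I"
  obtains Y where "Y \<in> bases I" "X \<subseteq> Y" "Y \<subseteq> X \<union> B"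
proof -
  let ?S = "{Y \<in> I. X \<subseteq> Y \<and> Y \<subseteq> X \<union> B}"
  have "?S \<subseteq> Pow E" using indep_ground by blast
  then have "finite ?S" using finite_ground finite_subset by blast
  moreover have "X \<in> ?S" using X by simp
  ultimately obtain Y where Y: "Y \<in> ?S" "\<forall>Z\<in>?S. Y \<le> Z \<longrightarrow> Y = Z"
    by (meson finite_has_maximal2)
  have "card B \<le> card Y"
  proof (rule ccontr)
    assume "\<not> ?thesis"
    then obtain y where y: "y \<in> B - Y" "insert y Y \<in> I"
      using indep_augment[of Y B] Y B by (auto simp: bases_def)
    then have "insert y Y \<in> ?S" using Y by auto
    then show False using Y(2) y by blast
  qed
  then have "Y \<in> bases I" using indep_card_basis Y B by blast
  then show ?thesis using that Y by blast
qed

text \<open>Orthogonality of circuits and cocircuits. If they met only in \<open>d\<close>, extend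
  \<open>X - {d}\<close> to a basis by elements of a basis avoiding \<open>D - {d}\<close>. This
  basis can meet \<open>D\<close> only in \<open>d\<close>, so it contains \<open>d\<close> and with
  it the whole circuit.\<close>

lemma circuit_cocircuit_inter:
  assumes X: "X \<in> circuits E I" and D: "D \<in> cocircuits E I"
  shows "X \<inter> D \<noteq> {d}"
proof
  assume eq: "X \<inter> D = {d}"
  have "D - {d} \<subset> D" using eq by blast
  then have "D - {d} \<in> dual_indep E I"
    using D by (simp add: cocircuits_def circuits_def)
  then obtain B where B: "B \<in> bases I" "(D - {d}) \<inter> B = {}" by (auto simp: dual_indep_def)
  have "X - {d} \<subset> X" using eq by blast
  then have "X - {d} \<in> I" using X by (simp add: circuits_def)
  then obtain Y where Y: "Y \<in> bases I" "X - {d} \<subseteq> Y" "Y \<subseteq> (X - {d}) \<union> B"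
    using indep_extend_from_basis B(1) by blast
  have "d \<in> Y" using basis_meets_cocircuit[OF Y(1) D] Y(3) B(2) eq by blast
  then have "X \<subseteq> Y" using Y by blast
  then have "X \<in> I" using Y(1) indep_subset by (auto simp: bases_def)
  then show False using X by (simp add: circuits_def)
qed

end

section \<open>Chains over a skew partial field and the cocircuits they support\<close>

locale represented_matroid = partial_field_chain_group R G E C + matroid E I
  for R (structure) and G and E :: "'e set" and C and I +
  assumes cocircuits_eq: "cocircuits E I = chain_support R E ` elementary_chains R E C"
begin

text \<open>Chains multiply from the left, in keeping with left closure of \<open>C\<close>, so
  relations can be scaled from the right. Values outside \<open>E\<close> are left free, so that
  pointwise sums and multiples need no restriction to \<open>E\<close>.\<close>

definition relations :: "('e \<Rightarrow> 'a) set" where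
  "relations = {x \<in> E \<rightarrow> carrier R. \<forall>c\<in>C. (\<Oplus>e\<in>E. c e \<otimes> x e) = \<zero>}"

lemma G_Units: "g \<in> G \<Longrightarrow> g \<in> Units R"
  using subgroup.subset[OF subgroup_units] by (auto simp: units_of_def)

lemma mult_G: "g \<in> G \<Longrightarrow> h \<in> G \<Longrightarrow> g \<otimes> h \<in> G"
  using subgroup.m_closed[OF subgroup_units] by (simp add: units_of_def)

lemma inv_G: "g \<in> G \<Longrightarrow> inv g \<in> G"
  using subgroup.m_inv_closed[OF subgroup_units] G_Units by (simp add: units_of_inv)

lemma chain_closed [simp]: "c \<in> C \<Longrightarrow> e \<in> E \<Longrightarrow> c e \<in> carrier R"
  using chains by (auto simp: PiE_def)

lemma chain_support_contains_elementary:
  assumes "c \<in> C" "c \<noteq> (\<lambda>e\<in>E. \<zero>)"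
  obtains d where "d \<in> elementary_chains R E C" "chain_support R E d \<subseteq> chain_support R E c"
proof -
  have "\<exists>d\<in>elementary_chains R E C. chain_support R E d \<subseteq> chain_support R E c"
    using assms
  proof (induction "card (chain_support R E c)" arbitrary: c rule: less_induct)
    case less
    show ?case
    proof (cases "c \<in> elementary_chains R E C")
      case False
      then obtain d where d: "d \<in> C" "d \<noteq> (\<lambda>e\<in>E. \<zero>)"
          "chain_support R E d \<subset> chain_support R E c"
        using less.prems by (auto simp: elementary_chains_def)
      have "finite (chain_support R E c)" using finite_ground by (simp add: chain_support_def)
      then have "card (chain_support R E d) < card (chain_support R E c)"
        using d(3) psubset_card_mono by blast
      with less.hyps d show ?thesis by blast
    qed blast
  qed
  then show ?thesis using that by blast
qed

text \<open>The support of a nonzero chain contains that of an elementary chain, hence a cocircuit,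
  and every cocircuit meets \<open>B\<close>.\<close>

lemma chain_zero_on_basis:
  assumes c: "c \<in> C" and B: "B \<in> bases I" and z: "\<And>b. b \<in> B \<Longrightarrow> c b = \<zero>" and e: "e \<in> E"
  shows "c e = \<zero>"
proof (rule ccontr)
  assume "c e \<noteq> \<zero>"
  then have "c \<noteq> (\<lambda>e\<in>E. \<zero>)" using e by auto
  then obtain d where "d \<in> elementary_chains R E C"
      "chain_support R E d \<subseteq> chain_support R E c"
    using chain_support_contains_elementary c by blast
  then have "B \<inter> chain_support R E c \<noteq> {}"
    using basis_meets_cocircuit[OF B] cocircuits_eq by blast
  then show False using z by (auto simp: chain_support_def)
qed

text \<open>The factor \<open>r\<close> may be a zero divisor, but the nonzero entries of
  \<open>c\<close> are units, so \<open>r \<otimes> c e = \<zero>\<close> with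
  \<open>c e \<noteq> \<zero>\<close> would force \<open>r = \<zero>\<close>. Removing
  \<open>r\<close> therefore keeps the support.\<close>

lemma primitive_chain_of_cocircuit:
  assumes D: "D \<in> cocircuits E I"
  obtains c where "c \<in> C" "primitive_chain R G E c" "chain_support R E c = D"
proof -
  obtain a where a: "a \<in> elementary_chains R E C" "chain_support R E a = D"
    using D cocircuits_eq by auto
  obtain r c where c: "r \<in> carrier R" "c \<in> C" "primitive_chain R G E c"
      and ac: "a = (\<lambda>e\<in>E. r \<otimes> c e)"
    using elementary_multiple[OF a(1)] by auto
  have a0: "a \<noteq> (\<lambda>e\<in>E. \<zero>)" using a(1) by (auto simp: elementary_chains_def)
  have r0: "r \<noteq> \<zero>"
  proof
    assume "r = \<zero>"
    then have "a = (\<lambda>e\<in>E. \<zero>)" unfolding ac using c(2) by (auto simp: restrict_def)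
    then show False using a0 by simp
  qed
  have "r \<otimes> c e \<noteq> \<zero> \<longleftrightarrow> c e \<noteq> \<zero>" if e: "e \<in> E" for e
  proof
    assume ne: "c e \<noteq> \<zero>"
    then have u: "c e \<in> Units R" using c(3) e G_Units by (auto simp: primitive_chain_def)
    show "r \<otimes> c e \<noteq> \<zero>"
    proof
      assume "r \<otimes> c e = \<zero>"
      then have "r \<otimes> c e \<otimes> inv (c e) = \<zero>" using u by simp
      then show False using u c(1) r0 by (simp add: m_assoc Units_closed)
    qed
  qed (use c in auto)
  then have "chain_support R E c = D" using a(2) c(1) by (auto simp: chain_support_def ac)
  then show ?thesis using that c by blast
qed

text \<open>This chain is the row indexed by \<open>b\<close> of the standard representation with
  respect to \<open>B\<close>: the primitive chain of the fundamental cocircuit, scaled from the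
  left by the inverse of its entry at \<open>b\<close>.\<close>

lemma fundamental_chain:
  assumes B: "B \<in> bases I" and b: "b \<in> B"
  obtains c where "c \<in> C" "primitive_chain R G E c" "chain_support R E c \<in> cocircuits E I"
    "c b = \<one>" "chain_support R E c \<inter> B = {b}"
proof -
  obtain D where D: "D \<in> cocircuits E I" "D \<inter> B = {b}" using fundamental_cocircuit[OF B b] .
  obtain a where a: "a \<in> C" "primitive_chain R G E a" "chain_support R E a = D"
    using primitive_chain_of_cocircuit[OF D(1)] .
  have bE: "b \<in> E" using bases_ground[OF B] b by blast
  have "a b \<noteq> \<zero>" using D(2) a(3) by (auto simp: chain_support_def)
  then have abG: "a b \<in> G" using a(2) bE by (auto simp: primitive_chain_def)
  define g where "g = inv (a b)"
  have gG: "g \<in> G" using abG inv_G g_def by simp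
  have u: "g \<in> Units R" "inv g \<otimes> g = \<one>" using gG G_Units by auto
  let ?c = "\<lambda>e\<in>E. g \<otimes> a e"
  have nz: "g \<otimes> a e = \<zero> \<longleftrightarrow> a e = \<zero>" if "e \<in> E" for e
  proof
    assume "g \<otimes> a e = \<zero>"
    then have "inv g \<otimes> (g \<otimes> a e) = \<zero>" using u by simp
    then show "a e = \<zero>" using u that a(1) by (simp add: Units_closed flip: m_assoc)
  qed (use u in \<open>simp add: Units_closed\<close>)
  have supp: "chain_support R E ?c = D" using a(3) nz by (auto simp: chain_support_def)
  have "?c \<in> C" using smult_chain a(1) u by blast
  moreover have "primitive_chain R G E ?c"
    using a(2) gG mult_G nz by (auto simp: primitive_chain_def)
  moreover have "?c b = \<one>" using bE abG G_Units by (simp add: g_def)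
  ultimately show ?thesis using that D supp by metis
qed

text \<open>The locale \<open>ring\<close> admits the zero ring; this excludes it, so that a unit
  equal to zero is a contradiction.\<close>

lemma one_not_zero:
  assumes "B \<in> bases I" "B \<noteq> {}"
  shows "\<one> \<noteq> \<zero>"
proof -
  obtain b where "b \<in> B" using assms by blast
  then obtain c where "c b = \<one>" "chain_support R E c \<inter> B = {b}"
    using fundamental_chain assms(1) by metis
  then show ?thesis by (auto simp: chain_support_def)
qed

section \<open>Expansion of chains over a basis, and the relation of a circuit\<close>

lemma chain_combination:
  assumes fin: "finite J" and A: "\<And>j. j \<in> J \<Longrightarrow> a j \<in> C" and r: "r \<in> J \<rightarrow> carrier R"
  shows "(\<lambda>e\<in>E. \<Oplus>j\<in>J. r j \<otimes> a j e) \<in> C"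
  using fin A r
proof (induction J)
  case empty
  then show ?case using zero_chain by (simp add: restrict_def)
next
  case (insert j J)
  have "(\<lambda>e\<in>E. (\<lambda>e\<in>E. r j \<otimes> a j e) e \<oplus> (\<lambda>e\<in>E. \<Oplus>j\<in>J. r j \<otimes> a j e) e) \<in> C"
    using insert by (intro add_chain smult_chain) auto
  also have "(\<lambda>e\<in>E. (\<lambda>e\<in>E. r j \<otimes> a j e) e \<oplus> (\<lambda>e\<in>E. \<Oplus>j\<in>J. r j \<otimes> a j e) e)
      = (\<lambda>e\<in>E. \<Oplus>j\<in>insert j J. r j \<otimes> a j e)"
    using insert by (intro restrict_ext) (simp add: Pi_def)
  finally show ?case .
qed

text \<open>The difference, built as a sum with a left multiple by minus one, is a chain vanishing
  on \<open>B\<close>.\<close>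

lemma chain_eq_on_basis:
  assumes c: "c \<in> C" and d: "d \<in> C" and B: "B \<in> bases I"
    and eq: "\<And>b. b \<in> B \<Longrightarrow> c b = d b" and e: "e \<in> E"
  shows "c e = d e"
proof -
  have m: "(\<lambda>e\<in>E. \<ominus> \<one> \<otimes> d e) \<in> C" using d by (intro smult_chain) auto
  let ?f = "\<lambda>e\<in>E. c e \<oplus> (\<lambda>e\<in>E. \<ominus> \<one> \<otimes> d e) e"
  have f: "?f x = c x \<ominus> d x" if "x \<in> E" for x
    using that d by (simp add: l_minus minus_eq)
  have "?f e = \<zero>"
  proof (rule chain_zero_on_basis[OF add_chain[OF c m] B _ e])
    fix b assume "b \<in> B"
    then show "?f b = \<zero>" using f[of b] eq[of b] bases_ground[OF B] d by auto
  qed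
  then have "c e \<ominus> d e = \<zero>" using f[OF e] by metis
  then show ?thesis using c d e by simp
qed

text \<open>Extend \<open>X - {d}\<close> to a basis \<open>B\<close>. In the matrix whose rows are
  the fundamental chains of \<open>B\<close>, the columns in \<open>B\<close> form an identity
  matrix, so column \<open>d\<close> is their right combination with coefficients
  \<open>a b d\<close>. Orthogonality shows that exactly the coefficients with
  \<open>b \<in> X\<close> are nonzero.\<close>

lemma circuit_relation:
  assumes X: "X \<in> circuits E I"
  obtains x where "x \<in> relations" "\<And>e. e \<in> X \<Longrightarrow> x e \<in> Units R" "\<And>e. e \<notin> X \<Longrightarrow> x e = \<zero>"
proof -
  have XE: "X \<subseteq> E" using X by (simp add: circuits_def)
  have "X \<noteq> {}" using X indep_empty by (auto simp: circuits_def)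
  then obtain d where d: "d \<in> X" by blast
  have "X - {d} \<subset> X" using d by blast
  then have "X - {d} \<in> I" using X by (simp add: circuits_def)
  then obtain B where B: "B \<in> bases I" "X - {d} \<subseteq> B" using indep_in_basis by blast
  have BE: "B \<subseteq> E" and finB: "finite B"
    using bases_ground[OF B(1)] finite_ground finite_subset by auto
  have dB: "d \<notin> B"
  proof
    assume "d \<in> B"
    then have "X \<subseteq> B" using B by blast
    then show False using B(1) X indep_subset by (auto simp: bases_def circuits_def)
  qed
  have "\<forall>b\<in>B. \<exists>c. c \<in> C \<and> primitive_chain R G E c \<and> chain_support R E c \<in> cocircuits E I \<and>
      c b = \<one> \<and> chain_support R E c \<inter> B = {b}"
    using fundamental_chain[OF B(1)] by metis
  then obtain a where a: "\<And>b. b \<in> B \<Longrightarrow> a b \<in> C" "\<And>b. b \<in> B \<Longrightarrow> primitive_chain R G E (a b)"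
      "\<And>b. b \<in> B \<Longrightarrow> chain_support R E (a b) \<in> cocircuits E I"
      "\<And>b. b \<in> B \<Longrightarrow> a b b = \<one>" "\<And>b. b \<in> B \<Longrightarrow> chain_support R E (a b) \<inter> B = {b}"
    by metis
  have ad: "a b d \<in> carrier R" if "b \<in> B" for b
    using a(1)[OF that] d XE by auto
  have offdiag: "a b b' = \<zero>" if "b \<in> B" "b' \<in> B" "b \<noteq> b'" for b b'
    using a(5)[of b] that BE by (auto simp: chain_support_def)
  have supp: "a b d \<noteq> \<zero> \<longleftrightarrow> b \<in> X" if b: "b \<in> B" for b
  proof -
    let ?D = "chain_support R E (a b)"
    \<comment> \<open>Within \<open>B\<close> the circuit and the cocircuit share at most
      \<open>b\<close>, and outside \<open>B\<close> at most \<open>d\<close>. Since they cannot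
      share exactly one element, \<open>b\<close> and \<open>d\<close> are shared together or not at
      all.\<close>
    have sub: "X \<inter> ?D \<subseteq> {b, d}" and bD: "b \<in> ?D" using B(2) a(5)[OF b] by blast+
    have "d \<in> ?D \<longleftrightarrow> b \<in> X"
    proof
      assume "d \<in> ?D"
      show "b \<in> X"
      proof (rule ccontr)
        assume "b \<notin> X"
        then have "X \<inter> ?D = {d}" using sub d \<open>d \<in> ?D\<close> by blast
        then show False using circuit_cocircuit_inter[OF X a(3)[OF b]] by blast
      qed
    next
      assume "b \<in> X"
      show "d \<in> ?D"
      proof (rule ccontr)
        assume "d \<notin> ?D"
        then have "X \<inter> ?D = {b}" using sub bD \<open>b \<in> X\<close> by blast
        then show False using circuit_cocircuit_inter[OF X a(3)[OF b]] by blast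
      qed
    qed
    then show ?thesis using d XE by (auto simp: chain_support_def)
  qed
  \<comment> \<open>The combination of the columns in \<open>B\<close> that gives column
    \<open>d\<close>, with column \<open>d\<close> moved to the same side.\<close>
  define x where "x e = (if e \<in> B then a e d else if e = d then \<ominus> \<one> else \<zero>)" for e
  have xE: "x e \<in> carrier R" for e by (auto simp: x_def ad)
  \<comment> \<open>A chain is determined by its entries on \<open>B\<close>, and there it agrees
    with the combination of fundamental chains having these entries as left coefficients.\<close>
  have expand: "c d = (\<Oplus>b\<in>B. c b \<otimes> a b d)" if c: "c \<in> C" for c
  proof -
    have cB: "c \<in> B \<rightarrow> carrier R" using c BE by auto
    let ?s = "\<lambda>e\<in>E. \<Oplus>b\<in>B. c b \<otimes> a b e"
    have "c d = ?s d"
    proof (rule chain_eq_on_basis[OF c chain_combination[OF finB a(1) cB] B(1)])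
      fix b assume b: "b \<in> B"
      have "(\<Oplus>b'\<in>B. c b' \<otimes> a b' b) = (\<Oplus>b'\<in>B. if b = b' then c b' else \<zero>)"
        using b a(4) offdiag funcset_mem[OF cB] by (intro finsum_cong') auto
      also have "\<dots> = c b" using finsum_singleton[OF b finB, of c] cB by simp
      finally show "c b = ?s b" using b BE by auto
    qed (use d XE in auto)
    then show ?thesis using d XE by auto
  qed
  have "(\<Oplus>e\<in>E. c e \<otimes> x e) = \<zero>" if c: "c \<in> C" for c
  proof -
    have cl: "c e \<otimes> x e \<in> carrier R" if "e \<in> E" for e using c that xE by simp
    have "(\<Oplus>e\<in>E. c e \<otimes> x e) = (\<Oplus>e\<in>insert d B. c e \<otimes> x e)"
    proof (rule add.finprod_mono_neutral_cong_left[symmetric])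
      show "c e \<otimes> x e = \<zero>" if "e \<in> E - insert d B" for e using c that by (auto simp: x_def)
    qed (use finite_ground BE d XE cl in auto)
    also have "\<dots> = c d \<otimes> x d \<oplus> (\<Oplus>e\<in>B. c e \<otimes> x e)"
      using cl BE d XE dB finB by (intro finsum_insert) auto
    also have "(\<Oplus>e\<in>B. c e \<otimes> x e) = (\<Oplus>e\<in>B. c e \<otimes> a e d)"
      using BE c ad by (intro finsum_cong') (auto simp: x_def)
    also have "\<dots> = c d" using expand[OF c] by simp
    also have "c d \<otimes> x d \<oplus> c d = \<zero>"
      using c d XE dB by (auto simp: x_def r_minus l_neg)
    finally show ?thesis .
  qed
  then have "x \<in> relations" using xE by (auto simp: relations_def)
  moreover have "x e \<in> Units R" if "e \<in> X" for e
  proof (cases "e = d")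
    \<comment> \<open>The entry at \<open>d\<close> is minus one, a unit because it belongs to
      \<open>G\<close>.\<close>
    case True
    then show ?thesis using dB minus_one G_Units by (auto simp: x_def)
  next
    case False
    then have e: "e \<in> B" using that B by blast
    then have "a e d \<in> G" using supp[OF e] that a(2)[OF e] d XE by (auto simp: primitive_chain_def)
    then show ?thesis using e G_Units by (auto simp: x_def)
  qed
  moreover have "x e = \<zero>" if "e \<notin> X" for e
    using that d supp by (auto simp: x_def)
  ultimately show ?thesis using that by blast
qed

text \<open>Pairing \<open>x\<close> with the fundamental chain at \<open>e\<close> leaves only
  \<open>x e\<close>: the chain vanishes on the rest of \<open>B\<close>, and \<open>x\<close>
  vanishes off \<open>B\<close>.\<close>

lemma relation_on_basis:
  assumes x: "x \<in> relations" and B: "B \<in> bases I"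
    and z: "\<And>e. e \<in> E - B \<Longrightarrow> x e = \<zero>" and e: "e \<in> E"
  shows "x e = \<zero>"
proof (cases "e \<in> B")
  case True
  obtain c where c: "c \<in> C" "c e = \<one>" "chain_support R E c \<inter> B = {e}"
    using fundamental_chain[OF B True] by metis
  have xc: "x \<in> E \<rightarrow> carrier R" using x by (simp add: relations_def)
  have "c f \<otimes> x f = (if e = f then x f else \<zero>)" if "f \<in> E" for f
  proof (cases "f \<in> B")
    case True
    have "x f \<in> carrier R" using xc that by blast
    moreover have "c f = \<zero>" if "f \<noteq> e"
      using c(3) True that \<open>f \<in> E\<close> unfolding chain_support_def by blast
    ultimately show ?thesis using c(2) by auto
  next
    case False
    then show ?thesis using z[of f] that c(1) by auto
  qed
  then have "(\<Oplus>f\<in>E. c f \<otimes> x f) = (\<Oplus>f\<in>E. if e = f then x f else \<zero>)"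
    using xc by (intro finsum_cong') auto
  also have "\<dots> = x e" using finsum_singleton[OF e finite_ground xc] .
  finally show ?thesis using x c(1) by (simp add: relations_def)
qed (use z e in blast)

section \<open>The right module of relations\<close>

lemma relation_closed: "x \<in> relations \<Longrightarrow> e \<in> E \<Longrightarrow> x e \<in> carrier R"
  by (auto simp: relations_def)

lemma relation_rmult:
  assumes "x \<in> relations" "r \<in> carrier R"
  shows "(\<lambda>e. x e \<otimes> r) \<in> relations"
proof -
  have "(\<Oplus>e\<in>E. c e \<otimes> (x e \<otimes> r)) = \<zero>" if c: "c \<in> C" for c
  proof -
    have "(\<Oplus>e\<in>E. c e \<otimes> (x e \<otimes> r)) = (\<Oplus>e\<in>E. c e \<otimes> x e \<otimes> r)"
      using assms c relation_closed by (intro finsum_cong') (auto simp: m_assoc)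
    also have "\<dots> = (\<Oplus>e\<in>E. c e \<otimes> x e) \<otimes> r"
      using assms c relation_closed finite_ground by (intro finsum_ldistr[symmetric]) auto
    finally show ?thesis using assms c by (simp add: relations_def)
  qed
  moreover have "(\<lambda>e. x e \<otimes> r) \<in> E \<rightarrow> carrier R" using assms relation_closed by blast
  ultimately show ?thesis by (simp add: relations_def)
qed

lemma relation_add:
  assumes "x \<in> relations" "y \<in> relations"
  shows "(\<lambda>e. x e \<oplus> y e) \<in> relations"
proof -
  have "(\<Oplus>e\<in>E. c e \<otimes> (x e \<oplus> y e)) = \<zero>" if c: "c \<in> C" for c
  proof -
    have "(\<Oplus>e\<in>E. c e \<otimes> (x e \<oplus> y e)) = (\<Oplus>e\<in>E. c e \<otimes> x e \<oplus> c e \<otimes> y e)"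
      using assms c relation_closed by (intro finsum_cong') (auto simp: r_distr)
    also have "\<dots> = (\<Oplus>e\<in>E. c e \<otimes> x e) \<oplus> (\<Oplus>e\<in>E. c e \<otimes> y e)"
      using assms c relation_closed by (intro finsum_addf) auto
    finally show ?thesis using assms c by (simp add: relations_def)
  qed
  moreover have "(\<lambda>e. x e \<oplus> y e) \<in> E \<rightarrow> carrier R" using assms relation_closed by blast
  ultimately show ?thesis by (simp add: relations_def)
qed

text \<open>Subtraction is spelled as adding a right multiple by minus one, so that it follows from
  the two module operations.\<close>

lemma relation_diff:
  assumes x: "x \<in> relations" and y: "y \<in> relations"
  shows "(\<lambda>e. x e \<oplus> y e \<otimes> \<ominus> \<one>) \<in> relations"
  using relation_add[OF x relation_rmult[OF y]] by simp

lemma add_mult_minus_one_eq_zero_iff: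
  assumes "r \<in> carrier R" "s \<in> carrier R"
  shows "r \<oplus> s \<otimes> \<ominus> \<one> = \<zero> \<longleftrightarrow> r = s"
  using assms r_right_minus_eq[of r s] by (simp add: r_minus minus_eq)

text \<open>Right scaling by the unit \<open>inv (x d) \<otimes> u\<close> keeps units units and
  zeros zero.\<close>

lemma circuit_relation_scaled:
  assumes X: "X \<in> circuits E I" and d: "d \<in> X" and u: "u \<in> Units R"
  obtains x where "x \<in> relations" "\<And>e. e \<in> X \<Longrightarrow> x e \<in> Units R" "\<And>e. e \<notin> X \<Longrightarrow> x e = \<zero>"
    "x d = u"
proof -
  obtain x where x: "x \<in> relations" "\<And>e. e \<in> X \<Longrightarrow> x e \<in> Units R" "\<And>e. e \<notin> X \<Longrightarrow> x e = \<zero>"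
    using circuit_relation[OF X] by blast
  have r: "inv (x d) \<otimes> u \<in> Units R" using x(2)[OF d] u by simp
  show ?thesis
  proof (rule that[of "\<lambda>e. x e \<otimes> (inv (x d) \<otimes> u)"])
    show "x d \<otimes> (inv (x d) \<otimes> u) = u" using x(2)[OF d] u by (simp add: Units_closed flip: m_assoc)
  qed (use x r relation_rmult in auto)
qed

text \<open>The lines \<open>cd\<close> and \<open>ef\<close> meet in a point \<open>c p\<^sub>c + d p\<^sub>d\<close>, and the line \<open>ab\<close>, being coplanar
  with each of them but not lying in their common plane, passes through it.\<close>

lemma line_through_intersection:
  assumes p: "p \<in> relations" "\<And>g. g \<in> {c,d,e,f} \<Longrightarrow> p g \<in> Units R"
      "\<And>g. g \<notin> {c,d,e,f} \<Longrightarrow> p g = \<zero>"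
    and circ: "{a,b,c,d} \<in> circuits E I" "{a,b,e,f} \<in> circuits E I"
    and basis: "{a,b,d,f} \<in> bases I"
    and dist: "distinct [a,b,c,d,e,f]"
  obtains q where "q \<in> relations" "\<And>g. g \<in> {a,b,c,d} \<Longrightarrow> q g \<in> Units R"
    "\<And>g. g \<notin> {a,b,c,d} \<Longrightarrow> q g = \<zero>" "q c = p c" "q d = p d"
proof -
  obtain q where q: "q \<in> relations" "\<And>g. g \<in> {a,b,c,d} \<Longrightarrow> q g \<in> Units R"
      "\<And>g. g \<notin> {a,b,c,d} \<Longrightarrow> q g = \<zero>" "q c = p c"
    using circuit_relation_scaled[OF circ(1), of c "p c"] p(2) by auto
  obtain s where s: "s \<in> relations" "\<And>g. g \<in> {a,b,e,f} \<Longrightarrow> s g \<in> Units R"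
      "\<And>g. g \<notin> {a,b,e,f} \<Longrightarrow> s g = \<zero>" "s e = p e"
    using circuit_relation_scaled[OF circ(2), of e "p e"] p(2) by auto
  have E: "a \<in> E" "b \<in> E" "c \<in> E" "d \<in> E" "e \<in> E" "f \<in> E"
    using circ by (auto simp: circuits_def)
  \<comment> \<open>This is \<open>p - (q + s)\<close>. It vanishes at \<open>c\<close>, where
    \<open>q\<close> agrees with \<open>p\<close> and \<open>s\<close> is zero, and at
    \<open>e\<close> with the roles exchanged, so it lives on the basis \<open>{a,b,d,f}\<close>.
    Its entry at \<open>d\<close>, where \<open>s\<close> is zero, then compares \<open>q\<close>
    with \<open>p\<close>.\<close>
  let ?t = "\<lambda>g. p g \<oplus> (q g \<oplus> s g) \<otimes> \<ominus> \<one>"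
  have t: "?t \<in> relations" using relation_diff[OF p(1) relation_add[OF q(1) s(1)]] .
  have "?t d = \<zero>"
  proof (rule relation_on_basis[OF t basis])
    fix g assume g: "g \<in> E - {a,b,d,f}"
    then have cl: "p g \<in> carrier R" "q g \<in> carrier R" "s g \<in> carrier R"
      using p(1) q(1) s(1) relation_closed by auto
    consider "g = c" | "g = e" | "g \<notin> {a,b,c,d,e,f}" using g by blast
    then have "p g = q g \<oplus> s g"
      using cl p(3)[of g] q(3)[of g] q(4) s(3)[of g] s(4) dist by cases auto
    then show "?t g = \<zero>" using add_mult_minus_one_eq_zero_iff[of "p g" "q g \<oplus> s g"] cl by simp
  qed (rule E)
  then have "p d = q d \<oplus> s d"
    using add_mult_minus_one_eq_zero_iff[of "p d" "q d \<oplus> s d"] p(1) q(1) s(1) relation_closed E by auto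
  moreover have "s d = \<zero>" using s(3)[of d] dist by auto
  ultimately have "q d = p d" using q(1) E relation_closed by auto
  then show ?thesis using that q by blast
qed

end

section \<open>Circuits and bases of the Vamos matroid, and the contradiction\<close>

lemma vamos_plane_circuit:
  assumes P: "P \<in> vamos_planes"
  shows "P \<in> circuits vamos_ground vamos_indep"
proof -
  have PE: "P \<subseteq> vamos_ground" using P by (auto simp: vamos_planes_def vamos_ground_def)
  have "Y \<in> vamos_indep" if "Y \<subset> P" for Y
  proof -
    have "finite P" using PE finite_subset by (auto simp: vamos_ground_def)
    then have "card Y < 4" using that vamos_planes_card[OF P] psubset_card_mono by metis
    then show ?thesis using that PE vamos_planes_card[of Y] by (auto simp: vamos_indep_def)
  qed
  then show ?thesis using P PE by (auto simp: circuits_def vamos_indep_def)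
qed

lemma vamos_basis:
  assumes B: "B \<subseteq> vamos_ground" "card B = 4" "B \<notin> vamos_planes"
  shows "B \<in> bases vamos_indep"
proof -
  have "X = B" if X: "X \<in> vamos_indep" "B \<subseteq> X" for X
  proof -
    have "finite X" using X finite_subset by (auto simp: vamos_indep_def vamos_ground_def)
    then show ?thesis using X B(2) card_seteq[of X B] by (auto simp: vamos_indep_def)
  qed
  then show ?thesis using B by (auto simp: bases_def vamos_indep_def)
qed

theorem theorem3p34:
  fixes R :: "('a, 'b) ring_scheme" and G :: "'a set"
  assumes "skew_partial_field R G"
  shows "\<not> representable R G vamos_ground vamos_indep"
proof
  assume "representable R G vamos_ground vamos_indep"
  then obtain C where "partial_field_chain_group R G vamos_ground C"
      "is_chain_group_matroid R vamos_ground C vamos_indep"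
    by (auto simp: representable_def)
  then interpret represented_matroid R G vamos_ground C vamos_indep
    by (simp add: represented_matroid_def represented_matroid_axioms_def is_chain_group_matroid_def)
  let ?E = vamos_ground
  have circ: "{1,2,5,6} \<in> circuits ?E vamos_indep" "{1,2,7,8} \<in> circuits ?E vamos_indep"
      "{3,4,5,6} \<in> circuits ?E vamos_indep" "{3,4,7,8} \<in> circuits ?E vamos_indep"
      "{5,6,7,8} \<in> circuits ?E vamos_indep"
    by (rule vamos_plane_circuit, simp add: vamos_planes_def)+
  \<comment> \<open>A test separating the three sets below from the planes: the first two contain 6
    without 5, and the third contains neither 5 nor 7.\<close>
  have "(5 \<in> P \<longleftrightarrow> 6 \<in> P) \<and> (5 \<in> P \<or> 7 \<in> P)" if "P \<in> vamos_planes" for P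
    using that by (auto simp: vamos_planes_def)
  from this[of "{1,2,6,8}"] this[of "{3,4,6,8}"] this[of "{1,2,3,4}"]
  have basis: "{1,2,6,8} \<in> bases vamos_indep" "{3,4,6,8} \<in> bases vamos_indep"
      "{1,2,3,4} \<in> bases vamos_indep"
    by (auto intro!: vamos_basis simp: vamos_ground_def)
  obtain p where p: "p \<in> relations" "\<And>g. g \<in> {5,6,7,8} \<Longrightarrow> p g \<in> Units R"
      "\<And>g. g \<notin> {5,6,7,8} \<Longrightarrow> p g = \<zero>\<^bsub>R\<^esub>"
    using circuit_relation[OF circ(5)] by metis
  obtain q where q: "q \<in> relations" "\<And>g. g \<in> {1,2,5,6} \<Longrightarrow> q g \<in> Units R"
      "\<And>g. g \<notin> {1,2,5,6} \<Longrightarrow> q g = \<zero>\<^bsub>R\<^esub>" "q 5 = p 5" "q 6 = p 6"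
    using line_through_intersection[OF p circ(1,2) basis(1)] by auto
  obtain s where s: "s \<in> relations" "\<And>g. g \<in> {3,4,5,6} \<Longrightarrow> s g \<in> Units R"
      "\<And>g. g \<notin> {3,4,5,6} \<Longrightarrow> s g = \<zero>\<^bsub>R\<^esub>" "s 5 = p 5" "s 6 = p 6"
    using line_through_intersection[OF p circ(3,4) basis(2)] by auto
  \<comment> \<open>The difference \<open>q - s\<close> vanishes at 5 and 6, where both agree with
    \<open>p\<close>, and at 7 and 8, where both are zero. Hence it lives on the basis 1234 and is
    zero.\<close>
  let ?t = "\<lambda>g. q g \<oplus>\<^bsub>R\<^esub> s g \<otimes>\<^bsub>R\<^esub> \<ominus>\<^bsub>R\<^esub> \<one>\<^bsub>R\<^esub>"
  have "?t 1 = \<zero>\<^bsub>R\<^esub>"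
  proof (rule relation_on_basis[OF relation_diff[OF q(1) s(1)] basis(3)])
    fix g assume g: "g \<in> ?E - {1,2,3,4}"
    then consider "g = 5" | "g = 6" | "g \<notin> {1,2,3,4,5,6}" by blast
    then have "q g = s g" using q(3)[of g] q(4,5) s(3)[of g] s(4,5) by cases auto
    then show "?t g = \<zero>\<^bsub>R\<^esub>" using g q(1) s(1) relation_closed by (auto simp: add_mult_minus_one_eq_zero_iff)
  qed (simp add: vamos_ground_def)
  then have "q 1 = s 1"
    using add_mult_minus_one_eq_zero_iff[of "q 1" "s 1"] q(1) s(1) relation_closed by (auto simp: vamos_ground_def)
  then have "\<zero>\<^bsub>R\<^esub> \<in> Units R" using q(2)[of 1] s(3)[of 1] by simp
  then have "\<one>\<^bsub>R\<^esub> = \<zero>\<^bsub>R\<^esub>" by (metis Units_r_inv Units_inv_closed l_null)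
  then show False using one_not_zero[OF basis(3)] by simp
qed

end
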